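(* Let $Y$ be a continuum which is (homeomorphic to) the inverse limit of an inverse sequence, with continuous bonding maps, of mutually homeomorphic topological graphs. Then the following are equivalent: (a) $Y$ is indecomposable; (b) some meager composant of $Y$ is singular dense in $Y$; (c) every meager composant of $Y$ is singular dense in $Y$.
   Context: A continuum is a connected compact metrizable space with more than one point. A topological graph is a continuum that is the union of finitely many arcs, any two of which are disjoint or intersect only in one or both of their end points. A subcontinuum of a continuum $Y$ is a non-empty compact connected subset of $Y$ (one-point subsets are allowed). A continuum $Y$ is decomposable if $Y=H\cup K$ for some two proper subcontinua $H,K\subsetneq Y$; otherwise it is indecomposable. For a continuum $Y$ and $x\in Y$, the meager composant of $x$ in $Y$ is the union of all subcontinua of $Y$ that contain $x$ and are nowhere dense in $Y$; a meager composant of $Y$ is the meager composant of some point of $Y$. A connected subset $X$ of a continuum $Y$ is singular with respect to a point $y\in Y$ if for every connected $C\subseteq X$ such that $y$ belongs to the closure of $C$ in $Y$, the closure of $C$ in $X$ equals $X$. $X$ is singular in $Y$ if it is singular with respect to some $y\in Y$, and singular dense in $Y$ if it is both singular in $Y$ and dense in $Y$. *)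

theory Defs
  imports "HOL-Analysis.Analysis"
begin

definition continuum :: "'a topology \<Rightarrow> bool" where
  "continuum Y \<longleftrightarrow> connected_space Y \<and> compact_space Y \<and> metrizable_space Y \<and>
     (\<exists>x\<in>topspace Y. \<exists>y\<in>topspace Y. x \<noteq> y)"

definition arc_between :: "'a topology \<Rightarrow> 'a set \<Rightarrow> 'a \<Rightarrow> 'a \<Rightarrow> bool" where
  "arc_between X A p q \<longleftrightarrow> A \<subseteq> topspace X \<and>
     (\<exists>h. homeomorphic_map (top_of_set {0..1::real}) (subtopology X A) h \<and> h 0 = p \<and> h 1 = q)"

(* The set {p, q} of end points of an arc does not depend on the chosen homeomorphism,
   so quantifying over all p, q, r, s below just names the end points of A and of B. *)
definition topological_graph :: "'a topology \<Rightarrow> bool" where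
  "topological_graph X \<longleftrightarrow> continuum X \<and>
     (\<exists>\<A>. finite \<A> \<and> \<Union>\<A> = topspace X \<and>
        (\<forall>A\<in>\<A>. \<exists>p q. arc_between X A p q) \<and>
        (\<forall>A\<in>\<A>. \<forall>B\<in>\<A>. A \<noteq> B \<longrightarrow>
           (\<forall>p q r s. arc_between X A p q \<longrightarrow> arc_between X B r s \<longrightarrow>
              A \<inter> B \<subseteq> {p, q} \<inter> {r, s})))"

definition subcontinuum :: "'a topology \<Rightarrow> 'a set \<Rightarrow> bool" where
  "subcontinuum Y K \<longleftrightarrow> K \<noteq> {} \<and> compactin Y K \<and> connectedin Y K"

(* Used only when Y is a continuum; the same holds for indecomposable. *)
definition decomposable :: "'a topology \<Rightarrow> bool" where
  "decomposable Y \<longleftrightarrow>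
     (\<exists>H K. subcontinuum Y H \<and> subcontinuum Y K \<and> H \<subset> topspace Y \<and> K \<subset> topspace Y \<and>
        topspace Y = H \<union> K)"

definition indecomposable :: "'a topology \<Rightarrow> bool" where
  "indecomposable Y \<longleftrightarrow> \<not> decomposable Y"

definition nowhere_dense_in :: "'a topology \<Rightarrow> 'a set \<Rightarrow> bool" where
  "nowhere_dense_in Y S \<longleftrightarrow> S \<subseteq> topspace Y \<and> Y interior_of (Y closure_of S) = {}"

definition meager_composant_of :: "'a topology \<Rightarrow> 'a \<Rightarrow> 'a set" where
  "meager_composant_of Y x = \<Union>{K. subcontinuum Y K \<and> x \<in> K \<and> nowhere_dense_in Y K}"

definition meager_composants :: "'a topology \<Rightarrow> 'a set set" where
  "meager_composants Y = meager_composant_of Y ` topspace Y"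

(* The closure of C is taken in Y in the premise, and relative to X in the conclusion. *)
definition singular_wrt :: "'a topology \<Rightarrow> 'a set \<Rightarrow> 'a \<Rightarrow> bool" where
  "singular_wrt Y X y \<longleftrightarrow> connectedin Y X \<and> y \<in> topspace Y \<and>
     (\<forall>C. C \<subseteq> X \<and> connectedin Y C \<and> y \<in> Y closure_of C \<longrightarrow> subtopology Y X closure_of C = X)"

definition singular_in :: "'a topology \<Rightarrow> 'a set \<Rightarrow> bool" where
  "singular_in Y X \<longleftrightarrow> (\<exists>y. singular_wrt Y X y)"

definition singular_dense_in :: "'a topology \<Rightarrow> 'a set \<Rightarrow> bool" where
  "singular_dense_in Y X \<longleftrightarrow> singular_in Y X \<and> Y closure_of X = topspace Y"

(* The bonding maps are f n : G (Suc n) -> G n; they are not required to be surjective. *)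
definition inverse_limit :: "(nat \<Rightarrow> 'b topology) \<Rightarrow> (nat \<Rightarrow> 'b \<Rightarrow> 'b) \<Rightarrow> (nat \<Rightarrow> 'b) topology" where
  "inverse_limit G f = subtopology (product_topology G UNIV) {x. \<forall>n. f n (x (Suc n)) = x n}"

end

theory Submission
  imports Defs
begin

text \<open>A connected space is the union of two proper closed connected subsets as soon as it has a proper
  closed connected subset with interior. So the proper subcontinua of an indecomposable continuum are
  nowhere dense, its meager composants are its composants, and each of them is singular with respect
  to any point of another composant. Likewise, in a singular dense meager composant \<open>X\<close> every proper
  closed connected subset is nowhere dense. In an inverse limit of copies of one graph, the number of
  pairwise disjoint subcontinua that meet a subcontinuum \<open>H\<close> without being contained in it is
  bounded. If \<open>Y = H \<union> K\<close> were decomposable, only finitely many components of \<open>X \<inter> K\<close> could thus leave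
  \<open>H\<close>, and these nowhere dense sets would cover the non-empty open subset \<open>X - H\<close> of \<open>X\<close>.\<close>

section \<open>Connected sets with interior\<close>

text \<open>A separation of \<open>C \<union> A\<close> leaves the connected set \<open>C\<close> in
  one part, so the other part \<open>T\<close> lies in \<open>A\<close>. Then \<open>T\<close> is
  separated from \<open>B\<close> as well, and moving \<open>B\<close> to the side of
  \<open>C\<close> splits \<open>Z\<close>.\<close>

lemma connectedin_Un_separated_complement:
  assumes "connected_space Z" "connectedin Z C" "separatedin Z A B" "C \<union> A \<union> B = topspace Z"
  shows "connectedin Z (C \<union> A)"
proof (rule ccontr)
  have sub: "C \<union> A \<subseteq> topspace Z"
    using assms(4) by blast
  assume "\<not> connectedin Z (C \<union> A)"
  then obtain S T where ST: "S \<union> T = C \<union> A" "S \<noteq> {}" "T \<noteq> {}" "separatedin Z S T"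
    using sub unfolding connectedin_eq_not_separated by blast
  have False if "C \<subseteq> S" "S \<union> T = C \<union> A" "S \<noteq> {}" "T \<noteq> {}" "separatedin Z S T" for S T
  proof -
    have "T \<subseteq> A"
      using that separatedin_imp_disjoint[OF that(5)] by (auto simp: disjnt_iff)
    then have "separatedin Z B T"
      using assms(3) separatedin_mono separatedin_sym by blast
    then have "separatedin Z (S \<union> B) T"
      using that(5) by simp
    moreover have "(S \<union> B) \<union> T = topspace Z"
      using assms(4) that(2) by blast
    ultimately show False
      using assms(1) that(3,4) unfolding connected_space_eq_not_separated by blast
  qed
  note no_split = this
  have "C \<subseteq> S \<union> T"
    using ST(1) by blast
  then consider "C \<subseteq> S" | "C \<subseteq> T"
    using connectedin_subset_separated_union[OF assms(2) ST(4)] by blast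
  then show False
  proof cases
    case 1
    then show False using no_split ST by blast
  next
    case 2
    then show False using no_split[of T S] ST separatedin_sym by (metis Un_commute)
  qed
qed

text \<open>If the complement of \<open>C\<close> is connected, its closure is the second piece; the
  interior of \<open>C\<close> keeps that closure proper. If the complement splits into separated
  sets \<open>A\<close> and \<open>B\<close>, the pieces are \<open>C \<union> A\<close> and
  \<open>C \<union> B\<close>.\<close>

lemma closed_connected_cover_if_interior:
  assumes "connected_space Z" "closedin Z C" "connectedin Z C"
    and "Z interior_of C \<noteq> {}" "C \<noteq> topspace Z"
  obtains P Q where "closedin Z P" "connectedin Z P" "P \<noteq> topspace Z"
    and "closedin Z Q" "connectedin Z Q" "Q \<noteq> topspace Z" "P \<union> Q = topspace Z"
proof (cases "connectedin Z (topspace Z - C)")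
  case True
  let ?Q = "Z closure_of (topspace Z - C)"
  have "?Q \<noteq> topspace Z"
    using assms(4) by (auto simp: interior_of_closure_of)
  moreover have "C \<union> ?Q = topspace Z"
    using closedin_subset[OF assms(2)] closure_of_subset[of "topspace Z - C" Z]
      closure_of_subset_topspace[of Z "topspace Z - C"] by blast
  ultimately show ?thesis
    using that[of C ?Q] assms True by (simp add: connectedin_closure_of)
next
  case False
  then obtain A B where AB: "A \<union> B = topspace Z - C" "A \<noteq> {}" "B \<noteq> {}" "separatedin Z A B"
    unfolding connectedin_eq_not_separated by blast
  have half: "closedin Z (C \<union> A) \<and> connectedin Z (C \<union> A) \<and> C \<union> A \<noteq> topspace Z"
    if "A \<union> B = topspace Z - C" "B \<noteq> {}" "separatedin Z A B" for A B
  proof (intro conjI)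
    have eq: "C \<union> A \<union> B = topspace Z"
      using that(1) closedin_subset[OF assms(2)] by blast
    show "connectedin Z (C \<union> A)"
      by (rule connectedin_Un_separated_complement[OF assms(1,3) that(3) eq])
    have "Z closure_of A \<subseteq> C \<union> A"
      using that(3) eq closure_of_subset_topspace[of Z A] unfolding separatedin_def by blast
    then have "Z closure_of (C \<union> A) \<subseteq> C \<union> A"
      by (simp add: closure_of_closedin[OF assms(2)])
    then show "closedin Z (C \<union> A)"
      using eq closure_of_subset_eq by blast
    show "C \<union> A \<noteq> topspace Z"
      using that separatedin_imp_disjoint[OF that(3)] by (auto simp: disjnt_iff)
  qed
  have "(C \<union> A) \<union> (C \<union> B) = topspace Z"
    using AB(1) closedin_subset[OF assms(2)] by blast
  moreover have "B \<union> A = topspace Z - C" "separatedin Z B A"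
    using AB separatedin_sym by (auto simp: Un_commute)
  ultimately show ?thesis
    using that[of "C \<union> A" "C \<union> B"] half[of A B] half[of B A] AB by blast
qed

section \<open>Meager composants\<close>

lemma continuum_Hausdorff: "continuum Y \<Longrightarrow> Hausdorff_space Y"
  by (simp add: continuum_def metrizable_imp_Hausdorff_space)

lemma subcontinuum_iff_closedin:
  assumes "continuum Y"
  shows "subcontinuum Y K \<longleftrightarrow> K \<noteq> {} \<and> closedin Y K \<and> connectedin Y K"
  using assms continuum_Hausdorff[OF assms] unfolding subcontinuum_def continuum_def
  by (meson closedin_compact_space compactin_imp_closedin)

lemma nowhere_dense_in_closedin_iff:
  "closedin Y K \<Longrightarrow> nowhere_dense_in Y K \<longleftrightarrow> Y interior_of K = {}"
  by (simp add: nowhere_dense_in_def closure_of_closedin closedin_subset)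

lemma meager_composant_connectedin: "connectedin Y (meager_composant_of Y x)"
  unfolding meager_composant_of_def
proof (cases "{K. subcontinuum Y K \<and> x \<in> K \<and> nowhere_dense_in Y K} = {}")
  case False
  then show "connectedin Y (\<Union>{K. subcontinuum Y K \<and> x \<in> K \<and> nowhere_dense_in Y K})"
    by (intro connectedin_Union) (auto simp: subcontinuum_def)
qed (metis Union_empty connectedin_empty)

text \<open>A meager composant need not be compact. Joining points of it inside one compact
  connected subset makes boundary bumping available there.\<close>

lemma meager_composant_finite_subset:
  assumes "finite F" "F \<subseteq> meager_composant_of Y x" "F \<noteq> {}"
  obtains M where "subcontinuum Y M" "F \<subseteq> M" "M \<subseteq> meager_composant_of Y x"
proof -
  have "\<forall>p\<in>F. \<exists>M. subcontinuum Y M \<and> x \<in> M \<and> nowhere_dense_in Y M \<and> p \<in> M"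
    using assms(2) unfolding meager_composant_of_def by blast
  then obtain M where M: "\<And>p. p \<in> F \<Longrightarrow> subcontinuum Y (M p) \<and> x \<in> M p \<and> nowhere_dense_in Y (M p) \<and> p \<in> M p"
    by metis
  have "connectedin Y (\<Union>(M ` F))"
    using M assms(3) by (intro connectedin_Union) (auto simp: subcontinuum_def)
  moreover have "compactin Y (\<Union>(M ` F))"
    using M assms(1) by (intro compactin_Union) (auto simp: subcontinuum_def)
  ultimately have "subcontinuum Y (\<Union>(M ` F))"
    using M assms(3) unfolding subcontinuum_def by blast
  then show ?thesis
    using that[of "\<Union>(M ` F)"] M unfolding meager_composant_of_def by blast
qed

lemma nowhere_dense_subcontinuum_Un:
  assumes Y: "continuum Y"
    and K: "subcontinuum Y K" "nowhere_dense_in Y K" and L: "subcontinuum Y L" "nowhere_dense_in Y L"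
    and "K \<inter> L \<noteq> {}"
  shows "subcontinuum Y (K \<union> L)" "nowhere_dense_in Y (K \<union> L)"
proof -
  have c: "closedin Y K" "closedin Y L"
    using K L subcontinuum_iff_closedin[OF Y] by auto
  show "subcontinuum Y (K \<union> L)"
    using assms subcontinuum_iff_closedin[OF Y] by (auto intro: connectedin_Un closedin_Un)
  show "nowhere_dense_in Y (K \<union> L)"
    using K(2) L(2) c interior_of_closedin_union_empty_interior_of[OF c(1), of L]
    by (simp add: nowhere_dense_in_closedin_iff closedin_Un)
qed

section \<open>Indecomposable continua\<close>

lemma indecomposable_nowhere_dense:
  assumes Y: "continuum Y" "indecomposable Y" and K: "subcontinuum Y K" "K \<noteq> topspace Y"
  shows "nowhere_dense_in Y K"
proof (rule ccontr)
  have c: "closedin Y K" "connectedin Y K"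
    using K subcontinuum_iff_closedin[OF Y(1)] by auto
  assume "\<not> nowhere_dense_in Y K"
  then have "Y interior_of K \<noteq> {}"
    using nowhere_dense_in_closedin_iff[OF c(1)] by blast
  then obtain P Q where PQ: "closedin Y P" "connectedin Y P" "P \<noteq> topspace Y"
    "closedin Y Q" "connectedin Y Q" "Q \<noteq> topspace Y" "P \<union> Q = topspace Y"
    using closed_connected_cover_if_interior[of Y K] c K(2) Y(1) unfolding continuum_def by metis
  \<comment> \<open>Neither piece is empty, since the other one is proper.\<close>
  then have "decomposable Y"
    unfolding decomposable_def subcontinuum_iff_closedin[OF Y(1)]
    by (intro exI[of _ P] exI[of _ Q]) auto
  then show False
    using Y(2) by (simp add: indecomposable_def)
qed

text \<open>Balls of radius \<open>1 / real (Suc n)\<close> around finite nets suffice. They serve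
  to give every proper closed set a member of a countable family in its complement.\<close>

lemma compact_metrizable_countable_pi_base:
  assumes "compact_space Y" "metrizable_space Y"
  obtains \<B> where "countable \<B>" "\<And>B. B \<in> \<B> \<Longrightarrow> openin Y B \<and> B \<noteq> {}"
    and "\<And>U. openin Y U \<Longrightarrow> U \<noteq> {} \<Longrightarrow> \<exists>B\<in>\<B>. B \<subseteq> U"
proof -
  obtain M d where Md: "Metric_space M d" and Y: "Y = Metric_space.mtopology M d"
    using assms(2) unfolding metrizable_space_def by blast
  interpret Metric_space M d by (rule Md)
  have "mtotally_bounded M"
    using assms(1) Y compact_space_eq_mcomplete_mtotally_bounded by simp
  then have "\<forall>n::nat. \<exists>F. finite F \<and> F \<subseteq> M \<and> M \<subseteq> (\<Union>x\<in>F. mball x (1 / real (Suc n)))"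
    unfolding mtotally_bounded_def by simp
  then obtain F where F: "\<And>n::nat. finite (F n)" "\<And>n. F n \<subseteq> M"
    "\<And>n. M \<subseteq> (\<Union>x\<in>F n. mball x (1 / real (Suc n)))"
    by metis
  define \<B> where "\<B> = (\<Union>n. (\<lambda>x. mball x (1 / real (Suc n))) ` F n)"
  show ?thesis
  proof
    show "countable \<B>"
      unfolding \<B>_def using F(1) by (auto intro: countable_finite)
    show "openin Y B \<and> B \<noteq> {}" if B: "B \<in> \<B>" for B
    proof -
      obtain n c where c: "c \<in> F n" "B = mball c (1 / real (Suc n))"
        using B unfolding \<B>_def by blast
      then have "c \<in> B"
        using F(2)[of n] by (auto simp del: of_nat_Suc)
      moreover have "openin Y B"
        using c(2) Y openin_mball by simp
      ultimately show ?thesis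
        by blast
    qed
    show "\<exists>B\<in>\<B>. B \<subseteq> U" if U: "openin Y U" "U \<noteq> {}" for U
    proof -
      obtain z where "z \<in> U"
        using U by blast
      then obtain e where e: "e > 0" "mball z e \<subseteq> U" and "z \<in> M"
        using U openin_mtopology unfolding Y by (meson subsetD)
      \<comment> \<open>Half of \<open>e\<close>, because \<open>z\<close> and the other points of
        the ball are compared through its centre \<open>c\<close>.\<close>
      obtain n where n: "1 / real (Suc n) < e / 2"
        using nat_approx_posE[of "e / 2"] e(1) by auto
      obtain c where c: "c \<in> F n" "z \<in> mball c (1 / real (Suc n))"
        using F(3) \<open>z \<in> M\<close> by blast
      have "mball c (1 / real (Suc n)) \<subseteq> mball z e"
      proof
        fix w
        assume w: "w \<in> mball c (1 / real (Suc n))"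
        have "d z w \<le> d c z + d c w"
          using triangle[of z c w] commute[of z c] w c(2) by auto
        then show "w \<in> mball z e"
          using w c(2) n by auto
      qed
      then show ?thesis
        using c(1) e(2) unfolding \<B>_def by blast
    qed
  qed
qed

text \<open>A nowhere dense subcontinuum through \<open>x\<close> misses some \<open>B\<close> of
  the countable family, so it lies in the component \<open>K B\<close> of \<open>x\<close> in the
  complement of \<open>B\<close>. These countably many closed sets have empty interior and cannot
  cover \<open>Y\<close>, by Baire category.\<close>

lemma indecomposable_meager_composant_proper:
  assumes Y: "continuum Y" "indecomposable Y" and x: "x \<in> topspace Y"
  obtains y where "y \<in> topspace Y" "y \<notin> meager_composant_of Y x"
proof -
  obtain \<B> where \<B>: "countable \<B>" "\<And>B. B \<in> \<B> \<Longrightarrow> openin Y B \<and> B \<noteq> {}"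
    "\<And>U. openin Y U \<Longrightarrow> U \<noteq> {} \<Longrightarrow> \<exists>B\<in>\<B>. B \<subseteq> U"
    using compact_metrizable_countable_pi_base[of Y] Y(1) unfolding continuum_def by metis
  define K where "K B = connected_component_of_set (subtopology Y (topspace Y - B)) x" for B
  have closed: "closedin Y (K B)" if "B \<in> \<B>" for B
  proof -
    have "closedin Y (topspace Y - B)"
      using \<B>(2) that by blast
    then show ?thesis
      unfolding K_def by (rule closedin_trans_full[OF closedin_connected_component_of])
  qed
  have conn: "connectedin Y (K B)" and sub: "K B \<subseteq> topspace Y - B" for B
    unfolding K_def
    using connectedin_connected_component_of[of "subtopology Y (topspace Y - B)" x]
    by (auto simp: connectedin_subtopology)
  \<comment> \<open>\<open>K B\<close> is empty if \<open>x\<close> lies in \<open>B\<close>;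
    otherwise it is a subcontinuum missing the nonempty set \<open>B\<close>, hence proper.\<close>
  have empty: "Y interior_of (K B) = {}" if "B \<in> \<B>" for B
  proof (cases "K B = {}")
    case False
    have "K B \<noteq> topspace Y"
      using \<B>(2)[OF that] sub[of B] openin_subset by blast
    then show ?thesis
      using indecomposable_nowhere_dense[OF Y, of "K B"] closed[OF that] conn False
      by (simp add: subcontinuum_iff_closedin[OF Y(1)] nowhere_dense_in_closedin_iff)
  qed auto
  have "Y interior_of \<Union>(K ` \<B>) = {}"
  proof (rule Baire_category_alt)
    show "completely_metrizable_space Y \<or> locally_compact_space Y \<and> regular_space Y"
      using Y(1) unfolding continuum_def
      by (simp add: compact_imp_locally_compact_space metrizable_imp_regular_space)
    show "countable (K ` \<B>)"
      using \<B>(1) by (rule countable_image)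
    show "closedin Y T \<and> Y interior_of T = {}" if "T \<in> K ` \<B>" for T
      using that closed empty by blast
  qed
  moreover have "Y interior_of topspace Y \<noteq> {}"
    using x by auto
  ultimately obtain y where y: "y \<in> topspace Y" "y \<notin> \<Union>(K ` \<B>)"
    by (metis interior_of_mono subset_empty subsetI)
  have "y \<notin> M" if M: "subcontinuum Y M" "x \<in> M" "nowhere_dense_in Y M" for M
  proof
    assume "y \<in> M"
    have c: "closedin Y M" "connectedin Y M"
      using M subcontinuum_iff_closedin[OF Y(1)] by auto
    have "M \<noteq> topspace Y"
      using M(3) x nowhere_dense_in_closedin_iff[OF c(1)] by auto
    then have "topspace Y - M \<noteq> {}" "openin Y (topspace Y - M)"
      using c(1) closedin_subset by blast+
    then obtain B where B: "B \<in> \<B>" "B \<subseteq> topspace Y - M"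
      using \<B>(3) by meson
    then have "connectedin (subtopology Y (topspace Y - B)) M"
      using c closedin_subset by (auto simp: connectedin_subtopology)
    then have "M \<subseteq> K B"
      unfolding K_def using M(2) by (rule connected_component_of_maximal)
    then show False
      using y(2) B(1) \<open>y \<in> M\<close> by blast
  qed
  then show ?thesis
    using that y(1) unfolding meager_composant_of_def by blast
qed

text \<open>If the closure \<open>?L\<close> were proper, the component \<open>?D\<close> of
  \<open>x\<close> in the complement of an open set \<open>V\<close> away from \<open>?L\<close>
  would be a proper subcontinuum, hence part of the meager composant. Yet boundary bumping makes it
  reach the boundary of \<open>V\<close>.\<close>

lemma meager_composant_dense:
  assumes Y: "continuum Y" "indecomposable Y" and x: "x \<in> topspace Y"
  shows "Y closure_of meager_composant_of Y x = topspace Y"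
proof (rule ccontr)
  let ?X = "meager_composant_of Y x"
  let ?L = "Y closure_of ?X"
  assume "?L \<noteq> topspace Y"
  then obtain z where z: "z \<in> topspace Y - ?L"
    using closure_of_subset_topspace[of Y ?X] by blast
  \<comment> \<open>Regularity provides a closed \<open>W\<close> around \<open>V\<close>, so that
    even the boundary of \<open>V\<close> misses \<open>?L\<close>.\<close>
  have "neighbourhood_base_of (closedin Y) Y"
    using Y(1) metrizable_imp_regular_space unfolding continuum_def neighbourhood_base_of_closedin by blast
  moreover have "openin Y (topspace Y - ?L)"
    by (simp add: openin_diff)
  ultimately obtain V W where VW: "openin Y V" "closedin Y W" "z \<in> V" "V \<subseteq> W" "W \<subseteq> topspace Y - ?L"
    using z unfolding neighbourhood_base_of by meson
  let ?S = "topspace Y - V"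
  let ?D = "connected_component_of_set (subtopology Y ?S) x"
  have XL: "?X \<subseteq> ?L"
    by (intro closure_of_subset connectedin_subset_topspace meager_composant_connectedin)
  have "{x} \<noteq> topspace Y"
    using Y(1) unfolding continuum_def by (metis singletonD)
  then have "nowhere_dense_in Y {x}"
    using indecomposable_nowhere_dense[OF Y, of "{x}"] x by (simp add: subcontinuum_def)
  then have "x \<in> ?X"
    using x unfolding meager_composant_of_def by (intro UnionI[of "{x}"]) (auto simp: subcontinuum_def)
  then have "x \<in> ?L"
    using XL by blast
  then have xS: "x \<in> ?S"
    using VW(4,5) x by blast
  have clS: "closedin Y ?S"
    using VW(1) by blast
  have "z \<in> topspace Y"
    using z by blast
  then have Sne: "?S \<noteq> topspace Y"
    using VW(3) by blast
  have Dcomp: "?D \<in> connected_components_of (subtopology Y ?S)"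
    using xS by (simp add: connected_component_in_connected_components_of)
  have meet: "?D \<inter> Y frontier_of ?S \<noteq> {}"
    using boundary_bumping_theorem_closed[OF _ _ continuum_Hausdorff[OF Y(1)] clS Sne Dcomp] Y(1)
    unfolding continuum_def by blast
  have Dx: "x \<in> ?D"
    using xS by (simp add: connected_component_of_refl)
  have Dcon: "connectedin Y ?D" "?D \<subseteq> ?S"
    using connectedin_connected_component_of[of "subtopology Y ?S" x]
    by (auto simp: connectedin_subtopology)
  have "closedin Y ?D"
    using clS by (rule closedin_trans_full[OF closedin_connected_component_of])
  then have D: "subcontinuum Y ?D"
    using Dcon Dx subcontinuum_iff_closedin[OF Y(1)] by blast
  moreover have "?D \<noteq> topspace Y"
    using Dcon(2) Sne closedin_subset[OF clS] by blast
  ultimately have "nowhere_dense_in Y ?D"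
    using indecomposable_nowhere_dense[OF Y] by blast
  then have "?D \<subseteq> ?X"
    using D Dx unfolding meager_composant_of_def by blast
  also note XL
  finally have "?D \<inter> W = {}"
    using VW(5) by blast
  moreover have "Y frontier_of ?S \<subseteq> W"
  proof -
    have "Y frontier_of ?S = Y frontier_of V"
      by (simp add: frontier_of_complement)
    also have "\<dots> \<subseteq> Y closure_of V"
      by (auto simp: frontier_of_def)
    also have "\<dots> \<subseteq> W"
      using VW(2,4) by (simp add: closure_of_minimal)
    finally show ?thesis .
  qed
  ultimately show False
    using meet by blast
qed

text \<open>Any \<open>y\<close> outside \<open>?X\<close> witnesses singularity. If the closure of
  a connected \<open>C\<close> in \<open>?X\<close> contained \<open>y\<close> and were proper, it
  would be a nowhere dense subcontinuum; its union with one joining \<open>x\<close> to a point of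
  \<open>C\<close> would put \<open>y\<close> into \<open>?X\<close>.\<close>

lemma indecomposable_meager_composant_singular_dense:
  assumes Y: "continuum Y" "indecomposable Y" and x: "x \<in> topspace Y"
  shows "singular_dense_in Y (meager_composant_of Y x)"
proof -
  let ?X = "meager_composant_of Y x"
  obtain y where y: "y \<in> topspace Y" "y \<notin> ?X"
    using indecomposable_meager_composant_proper[OF assms] .
  have Xsub: "?X \<subseteq> topspace Y"
    using meager_composant_connectedin connectedin_subset_topspace by metis
  have "Y closure_of C = topspace Y"
    if C: "C \<subseteq> ?X" "connectedin Y C" "y \<in> Y closure_of C" for C
  proof (rule ccontr)
    let ?L = "Y closure_of C"
    assume ne: "?L \<noteq> topspace Y"
    have L: "subcontinuum Y ?L"
      using C subcontinuum_iff_closedin[OF Y(1)] by (auto simp: connectedin_closure_of)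
    then have nd: "nowhere_dense_in Y ?L"
      using indecomposable_nowhere_dense[OF Y] ne by blast
    obtain c where c: "c \<in> C"
      using C(3) by force
    then obtain M where M: "subcontinuum Y M" "x \<in> M" "nowhere_dense_in Y M" "c \<in> M"
      using C(1) unfolding meager_composant_of_def by blast
    have "c \<in> ?L"
      using c closure_of_subset[OF connectedin_subset_topspace[OF C(2)]] by blast
    then have "M \<inter> ?L \<noteq> {}"
      using M(4) by blast
    note Un = nowhere_dense_subcontinuum_Un[OF Y(1) M(1,3) L nd this]
    have "y \<in> ?X"
      using Un M(2) C(3) unfolding meager_composant_of_def by (intro UnionI[of "M \<union> ?L"]) auto
    then show False
      using y(2) by blast
  qed
  \<comment> \<open>The closure in \<open>?X\<close> is the trace on \<open>?X\<close> of the
    closure in \<open>Y\<close>.\<close>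
  then have sing: "subtopology Y ?X closure_of C = ?X"
    if "C \<subseteq> ?X" "connectedin Y C" "y \<in> Y closure_of C" for C
    using that Xsub by (simp add: closure_of_subtopology inf_absorb2 inf_absorb1)
  have "singular_wrt Y ?X y"
    unfolding singular_wrt_def by (simp add: sing y(1) meager_composant_connectedin)
  then show ?thesis
    unfolding singular_dense_in_def singular_in_def
    using meager_composant_dense[OF assms] by blast
qed

section \<open>Topological graphs and their inverse limits\<close>

lemma topological_graph_Hausdorff: "topological_graph X \<Longrightarrow> Hausdorff_space X"
  by (simp add: topological_graph_def continuum_Hausdorff)

text \<open>The complement of the open subarc consists of the other arcs and the two end segments of
  \<open>A\<close>, finitely many compact sets. Other arcs meet \<open>A\<close> at most in
  \<open>h 0\<close> and \<open>h 1\<close>, which the open subarc omits.\<close>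

lemma openin_open_subarc:
  assumes "Hausdorff_space X" "finite \<A>" "\<Union>\<A> = topspace X"
    and arcs: "\<And>B. B \<in> \<A> \<Longrightarrow> compactin X B"
    and meet: "\<And>B. B \<in> \<A> \<Longrightarrow> B \<noteq> A \<Longrightarrow> A \<inter> B \<subseteq> {h 0, h 1}"
    and A: "A \<in> \<A>" and h: "homeomorphic_map (top_of_set {0..1::real}) (subtopology X A) h"
    and st: "0 \<le> s" "s \<le> t" "t \<le> 1"
  shows "closedin X (h ` {s..t})" "openin X (h ` {s<..<t})"
proof -
  have cont: "continuous_map (top_of_set {0..1}) X h"
    using h homeomorphic_imp_continuous_map continuous_map_in_subtopology by blast
  have inj: "inj_on h {0..1}"
    using homeomorphic_imp_injective_map[OF h] by simp
  have "topspace (subtopology X A) = A"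
    using A assms(3) by auto
  then have surj: "h ` {0..1} = A"
    using homeomorphic_imp_surjective_map[OF h] by simp
  have cl: "closedin X (h ` {u..v})" if "0 \<le> u" "v \<le> 1" for u v
  proof -
    have "compactin (top_of_set {0..1}) {u..v}"
      using that by (simp add: compactin_subtopology)
    then show ?thesis
      using image_compactin[OF _ cont] compactin_imp_closedin assms(1) by blast
  qed
  show "closedin X (h ` {s..t})"
    using cl st by blast
  let ?R = "\<Union>(\<A> - {A}) \<union> h ` {0..s} \<union> h ` {t..1}"
  have "closedin X ?R"
  proof (intro closedin_Un closedin_Union)
    show "closedin X B" if "B \<in> \<A> - {A}" for B
      using arcs compactin_imp_closedin[OF assms(1)] that by blast
  qed (use cl st assms(2) in auto)
  moreover have "h ` {s<..<t} = topspace X - ?R"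
  proof
    show "h ` {s<..<t} \<subseteq> topspace X - ?R"
    proof
      fix w
      assume "w \<in> h ` {s<..<t}"
      then obtain r where r: "w = h r" "s < r" "r < t"
        by auto
      have r01: "r \<in> {0..1}"
        using r st by auto
      then have wA: "w \<in> A"
        using r(1) surj by blast
      have "h r \<noteq> h u" if "u \<in> {0..1}" "u \<noteq> r" for u
        using inj_onD[OF inj] r01 that by metis
      note ne = this
      have "h r \<noteq> h u" if "u \<in> {0..s} \<union> {t..1}" for u
        using ne[of u] that r(2,3) st by auto
      then have out: "w \<notin> h ` {0..s}" "w \<notin> h ` {t..1}"
        unfolding r(1) by blast+
      have "w \<notin> {h 0, h 1}"
        using ne[of 0] ne[of 1] r st by auto
      then have "w \<notin> \<Union>(\<A> - {A})"
        using meet wA by blast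
      with out show "w \<in> topspace X - ?R"
        using wA A assms(3) by blast
    qed
    show "topspace X - ?R \<subseteq> h ` {s<..<t}"
    proof
      fix w
      assume w: "w \<in> topspace X - ?R"
      then have "w \<in> A"
        using assms(3) by blast
      then obtain r where "r \<in> {0..1}" "w = h r"
        using surj by blast
      moreover have "r \<in> {0..s} \<or> r \<in> {t..1} \<or> r \<in> {s<..<t}"
        using \<open>r \<in> {0..1}\<close> by auto
      ultimately show "w \<in> h ` {s<..<t}"
        using w by blast
    qed
  qed
  ultimately show "openin X (h ` {s<..<t})"
    by auto
qed

text \<open>As \<open>S\<close> avoids both end points, it meets the open and the closed subarc in
  the same set, which is thus open and closed in \<open>S\<close>.\<close>

lemma connectedin_subset_open_subarc:
  assumes "connectedin X S" "closedin X (h ` {s..t::real})" "openin X (h ` {s<..<t})"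
    and "h s \<notin> S" "h t \<notin> S" "S \<inter> h ` {s<..<t} \<noteq> {}"
  shows "S \<subseteq> h ` {s<..<t}"
proof (rule ccontr)
  assume not: "\<not> S \<subseteq> h ` {s<..<t}"
  have inside: "w \<in> h ` {s<..<t}" if w: "w \<in> S" "w \<in> h ` {s..t}" for w
  proof -
    obtain r where r: "w = h r" "s \<le> r" "r \<le> t"
      using w(2) by auto
    then have "r \<noteq> s" "r \<noteq> t"
      using assms(4,5) w(1) by auto
    then show ?thesis
      using r by auto
  qed
  have "h ` {s<..<t} \<subseteq> h ` {s..t}"
    by (intro image_mono) auto
  then have disj: "h ` {s<..<t} \<inter> (topspace X - h ` {s..t}) \<inter> S = {}"
    by blast
  have "S \<subseteq> h ` {s<..<t} \<union> (topspace X - h ` {s..t})"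
    using inside connectedin_subset_topspace[OF assms(1)] by blast
  moreover have "(topspace X - h ` {s..t}) \<inter> S \<noteq> {}"
    using not inside connectedin_subset_topspace[OF assms(1)] by blast
  moreover have "openin X (topspace X - h ` {s..t})"
    using assms(2) by blast
  ultimately show False
    using connectedinD[OF assms(1,3) _ _ disj] assms(6) by blast
qed

lemma three_points_ordered:
  fixes T :: "real set"
  assumes "card T \<ge> 3"
  obtains a b c where "a \<in> T" "b \<in> T" "c \<in> T" "a < b" "b < c"
proof -
  have fin: "finite T"
    using assms card.infinite by fastforce
  then have ne: "T \<noteq> {}" and "card (T - {Min T}) \<ge> 2"
    using assms by (auto simp: card_Diff_singleton_if)
  have "T - {Min T, Max T} \<noteq> {}"
  proof
    assume "T - {Min T, Max T} = {}"
    then have "card T \<le> card {Min T, Max T}"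
      by (intro card_mono) auto
    also have "\<dots> \<le> 2"
      by (simp add: card_insert_if)
    finally show False
      using assms by simp
  qed
  then obtain b where b: "b \<in> T" "b \<noteq> Min T" "b \<noteq> Max T"
    by blast
  then have "Min T < b" "b < Max T"
    using fin by (simp_all add: order.strict_iff_order)
  then show ?thesis
    using that b fin ne Min_in Max_in by metis
qed

text \<open>If the conclusion failed for more than twice as many indices as there are arcs, three points
  \<open>p i\<close>, each avoided by \<open>A\<close> and by the other sets \<open>B j\<close>, would lie on one arc. The middle one would
  confine \<open>A\<close> to the open subarc between the outer two, on one side of the middle point, and then
  the \<open>B j\<close> of the opposite outer point could not reach \<open>A\<close>.\<close>

lemma topological_graph_bound:
  assumes X: "topological_graph X"
  shows "\<exists>N. \<forall>(I::'i set) A B. N < card I \<longrightarrow> connectedin X A \<longrightarrow>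
      (\<forall>i\<in>I. connectedin X (B i) \<and> B i \<inter> A \<noteq> {}) \<longrightarrow> (\<exists>i\<in>I. B i \<subseteq> A \<union> \<Union>(B ` (I - {i})))"
proof -
  have H: "Hausdorff_space X"
    using X by (rule topological_graph_Hausdorff)
  obtain \<A> where \<A>: "finite \<A>" "\<Union>\<A> = topspace X" "\<forall>A\<in>\<A>. \<exists>p q. arc_between X A p q"
      "\<forall>A\<in>\<A>. \<forall>B\<in>\<A>. A \<noteq> B \<longrightarrow> (\<forall>p q r s. arc_between X A p q \<longrightarrow> arc_between X B r s \<longrightarrow>
        A \<inter> B \<subseteq> {p, q} \<inter> {r, s})"
    using X unfolding topological_graph_def by (elim conjE exE)
  define h where "h A = (SOME h. homeomorphic_map (top_of_set {0..1::real}) (subtopology X A) h)" for A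
  have h: "homeomorphic_map (top_of_set {0..1::real}) (subtopology X A) (h A)" if "A \<in> \<A>" for A
  proof -
    have "\<exists>h. homeomorphic_map (top_of_set {0..1::real}) (subtopology X A) h"
      using \<A>(3) that unfolding arc_between_def by blast
    then show ?thesis
      unfolding h_def by (rule someI_ex)
  qed
  have arc: "arc_between X A (h A 0) (h A 1)" if "A \<in> \<A>" for A
    unfolding arc_between_def using h that \<A>(2) by blast
  have surj: "h A ` {0..1} = A" if "A \<in> \<A>" for A
  proof -
    have "topspace (subtopology X A) = A"
      using that \<A>(2) by auto
    then show ?thesis
      using homeomorphic_imp_surjective_map[OF h[OF that]] by simp
  qed
  have inj: "inj_on (h A) {0..1}" if "A \<in> \<A>" for A
    using homeomorphic_imp_injective_map[OF h[OF that]] by simp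
  have comp: "compactin X A" if "A \<in> \<A>" for A
  proof -
    have "continuous_map (top_of_set {0..1}) X (h A)"
      using h[OF that] homeomorphic_imp_continuous_map continuous_map_in_subtopology by blast
    moreover have "compactin (top_of_set {0..1}) {0..1::real}"
      by (simp add: compactin_subtopology)
    ultimately show ?thesis
      using image_compactin surj[OF that] by metis
  qed
  have meet: "A \<inter> B \<subseteq> {h A 0, h A 1}" if "A \<in> \<A>" "B \<in> \<A>" "B \<noteq> A" for A B
  proof -
    have "A \<inter> B \<subseteq> {h A 0, h A 1} \<inter> {h B 0, h B 1}"
      by (rule \<A>(4)[rule_format, OF that(1,2) that(3)[THEN not_sym] arc[OF that(1)] arc[OF that(2)]])
    then show ?thesis
      by blast
  qed
  have trap: "S \<subseteq> h E ` {s<..<t}"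
    if "E \<in> \<A>" "connectedin X S" "0 \<le> s" "s \<le> t" "t \<le> 1" "h E s \<notin> S" "h E t \<notin> S"
      "S \<inter> h E ` {s<..<t} \<noteq> {}" for E S s t
  proof (rule connectedin_subset_open_subarc[OF that(2) _ _ that(6-8)])
    show "closedin X (h E ` {s..t})" "openin X (h E ` {s<..<t})"
      using openin_open_subarc[OF H \<A>(1,2) comp meet[OF that(1)] that(1) h[OF that(1)] that(3-5)]
      by auto
  qed
  show ?thesis
  proof (intro exI[of _ "2 * card \<A>"] allI impI)
    fix I :: "'i set" and A and B :: "'i \<Rightarrow> 'a set"
    assume card: "2 * card \<A> < card I" and A: "connectedin X A"
      and "\<forall>i\<in>I. connectedin X (B i) \<and> B i \<inter> A \<noteq> {}"
    then have B: "connectedin X (B i) \<and> B i \<inter> A \<noteq> {}" if "i \<in> I" for i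
      using that by blast
    show "\<exists>i\<in>I. B i \<subseteq> A \<union> \<Union>(B ` (I - {i}))"
    proof (rule ccontr)
      assume "\<not> ?thesis"
      then have "\<forall>i\<in>I. \<exists>p. p \<in> B i \<and> p \<notin> A \<and> (\<forall>j\<in>I. j \<noteq> i \<longrightarrow> p \<notin> B j)"
        by blast
      then obtain p where p: "\<And>i. i \<in> I \<Longrightarrow> p i \<in> B i" "\<And>i. i \<in> I \<Longrightarrow> p i \<notin> A"
        "\<And>i j. i \<in> I \<Longrightarrow> j \<in> I \<Longrightarrow> j \<noteq> i \<Longrightarrow> p i \<notin> B j"
        by metis
      have conn: "connectedin X (A \<union> B i)" if "i \<in> I" for i
        using B[OF that] A by (intro connectedin_Un) auto
      have "\<exists>E\<in>\<A>. p i \<in> E" if "i \<in> I" for i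
        using p(1)[OF that] B[OF that] connectedin_subset_topspace \<A>(2) by blast
      then obtain E where E: "\<And>i. i \<in> I \<Longrightarrow> E i \<in> \<A> \<and> p i \<in> E i"
        by metis
      have "\<exists>D\<in>\<A>. card {i\<in>I. E i = D} \<ge> 3"
      proof (rule ccontr)
        assume "\<not> ?thesis"
        then have le: "card {i\<in>I. E i = D} \<le> 2" if "D \<in> \<A>" for D
          using that by force
        have "I = (\<Union>D\<in>\<A>. {i\<in>I. E i = D})"
          using E by blast
        then have "card I \<le> (\<Sum>D\<in>\<A>. card {i\<in>I. E i = D})"
          using card_UN_le[OF \<A>(1), of "\<lambda>D. {i\<in>I. E i = D}"] by simp
        also have "\<dots> \<le> (\<Sum>D\<in>\<A>. 2)"
          using le by (intro sum_mono) auto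
        finally show False
          using card by simp
      qed
      then obtain D where D: "D \<in> \<A>" "card {i\<in>I. E i = D} \<ge> 3"
        by blast
      let ?J = "{i\<in>I. E i = D}"
      have "\<exists>r\<in>{0..1}. h D r = p i" if "i \<in> ?J" for i
      proof -
        have "p i \<in> h D ` {0..1}"
          using E[of i] that surj[OF D(1)] by simp
        then show ?thesis
          by (metis imageE)
      qed
      then obtain r where r: "\<And>i. i \<in> ?J \<Longrightarrow> r i \<in> {0..1} \<and> h D (r i) = p i"
        by metis
      have "inj_on r ?J"
      proof (rule inj_onI)
        fix i j
        assume ij: "i \<in> ?J" "j \<in> ?J" "r i = r j"
        then have "p i = p j"
          using r by metis
        then show "i = j"
          using p(1)[of i] p(3)[of j i] ij by auto
      qed
      then have "card (r ` ?J) \<ge> 3"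
        using D(2) by (simp add: card_image)
      then obtain a b c where abc: "a \<in> r ` ?J" "b \<in> r ` ?J" "c \<in> r ` ?J" "a < b" "b < c"
        by (rule three_points_ordered)
      then obtain i j k where ijk: "i \<in> ?J" "j \<in> ?J" "k \<in> ?J" and "a = r i" "b = r j" "c = r k"
        by (elim imageE)
      then have lt: "r i < r j" "r j < r k"
        using abc by auto
      have I: "i \<in> I" "j \<in> I" "k \<in> I"
        using ijk by auto
      have ne: "i \<noteq> j" "j \<noteq> k" "i \<noteq> k"
        using lt by auto
      have eq: "h D (r i) = p i" "h D (r j) = p j" "h D (r k) = p k"
        using r ijk by auto
      have bd: "0 \<le> r i" "r k \<le> 1"
        using r ijk by auto
      \<comment> \<open>\<open>B j\<close> links \<open>A\<close> to the middle point
        \<open>p j\<close>, and both sets avoid \<open>p i\<close> and \<open>p k\<close>.\<close>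
      have sub: "A \<union> B j \<subseteq> h D ` {r i<..<r k}"
      proof (rule trap[OF D(1) conn[OF I(2)]])
        have "p j \<in> h D ` {r i<..<r k}"
          using lt eq(2) by (metis greaterThanLessThan_iff imageI)
        then show "(A \<union> B j) \<inter> h D ` {r i<..<r k} \<noteq> {}"
          using p(1)[OF I(2)] by blast
      qed (use bd lt eq p I ne in auto)
      obtain a where a: "a \<in> A"
        using B[OF I(1)] by blast
      then obtain u where u: "u \<in> {r i<..<r k}" "a = h D u"
        using sub by blast
      \<comment> \<open>\<open>p j\<close> is not in \<open>A\<close>, so the point \<open>a\<close>
        of \<open>A\<close> lies strictly on one side of it.\<close>
      have "u \<noteq> r j"
        using a u eq p(2) I by metis
      then consider "u \<in> {r i<..<r j}" | "u \<in> {r j<..<r k}"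
        using u by fastforce
      then show False
      proof cases
        case 1
        \<comment> \<open>\<open>A \<union> B k\<close> avoids \<open>p i\<close> and
          \<open>p j\<close>, so it cannot leave the subarc between them, although it contains
          \<open>p k\<close>, which lies outside.\<close>
        have "A \<union> B k \<subseteq> h D ` {r i<..<r j}"
        proof (rule trap[OF D(1) conn[OF I(3)]])
          show "(A \<union> B k) \<inter> h D ` {r i<..<r j} \<noteq> {}"
            using 1 a u by blast
        qed (use bd lt eq p I ne in auto)
        then obtain v where v: "v \<in> {r i<..<r j}" "p k = h D v"
          using p(1)[OF I(3)] by blast
        then have "v = r k"
          using inj_onD[OF inj[OF D(1)], of v "r k"] eq bd lt by auto
        then show False
          using v lt by auto
      next
        case 2
        have "A \<union> B i \<subseteq> h D ` {r j<..<r k}"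
        proof (rule trap[OF D(1) conn[OF I(1)]])
          show "(A \<union> B i) \<inter> h D ` {r j<..<r k} \<noteq> {}"
            using 2 a u by blast
        qed (use bd lt eq p I ne in auto)
        then obtain v where v: "v \<in> {r j<..<r k}" "p i = h D v"
          using p(1)[OF I(1)] by blast
        then have "v = r i"
          using inj_onD[OF inj[OF D(1)], of v "r i"] eq bd lt by auto
        then show False
          using v lt by auto
      qed
    qed
  qed
qed

text \<open>Composing each coordinate with a homeomorphism onto \<open>G 0\<close> makes all
  projections land in a single graph, so that one bound serves at every level.\<close>

lemma inverse_limit_projections:
  fixes Y :: "'a topology" and G :: "nat \<Rightarrow> 'b topology"
  assumes G: "\<And>n. Hausdorff_space (G n)" "\<And>n. G n homeomorphic_space G 0"
    and Y: "Y homeomorphic_space inverse_limit G f"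
  obtains \<pi> :: "nat \<Rightarrow> 'a \<Rightarrow> 'b" where "\<forall>n. continuous_map Y (G 0) (\<pi> n)"
    and "\<forall>m n. m \<le> n \<longrightarrow> (\<forall>a\<in>topspace Y. \<forall>b\<in>topspace Y. \<pi> n a = \<pi> n b \<longrightarrow> \<pi> m a = \<pi> m b)"
    and "\<forall>a\<in>topspace Y. \<forall>b\<in>topspace Y. (\<forall>n. \<pi> n a = \<pi> n b) \<longrightarrow> a = b"
proof -
  obtain g where g: "\<And>n. homeomorphic_map (G n) (G 0) (g n)"
    using G(2) unfolding homeomorphic_space by metis
  obtain e where e: "homeomorphic_map Y (inverse_limit G f) e"
    using Y unfolding homeomorphic_space by blast
  have ce: "continuous_map Y (product_topology G UNIV) e"
    using homeomorphic_imp_continuous_map[OF e] continuous_map_in_subtopology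
    unfolding inverse_limit_def by blast
  have proj: "continuous_map Y (G n) (\<lambda>y. e y n)" for n
    using continuous_map_compose[OF ce continuous_map_product_projection[of n UNIV G]]
    by (simp add: o_def)
  have mem: "e y n \<in> topspace (G n)" if "y \<in> topspace Y" for y n
    using proj[of n] that by (simp add: continuous_map_def Pi_iff)
  have thread: "f n (e y (Suc n)) = e y n" if "y \<in> topspace Y" for y n
  proof -
    have "e y \<in> topspace (inverse_limit G f)"
      using homeomorphic_imp_surjective_map[OF e] that by blast
    then show ?thesis
      unfolding inverse_limit_def by simp
  qed
  have ginj: "e a n = e b n" if "a \<in> topspace Y" "b \<in> topspace Y" "g n (e a n) = g n (e b n)" for a b n
    using homeomorphic_imp_injective_map[OF g[of n]] that mem by (meson inj_onD)
  show ?thesis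
  proof (rule that[of "\<lambda>n y. g n (e y n)"]; intro allI ballI impI)
    show "continuous_map Y (G 0) (\<lambda>y. g n (e y n))" for n
      using continuous_map_compose[OF proj homeomorphic_imp_continuous_map[OF g]] by (simp add: o_def)
  next
    fix m n a b
    assume "m \<le> n" and ab: "a \<in> topspace Y" "b \<in> topspace Y" "g n (e a n) = g n (e b n)"
    from \<open>m \<le> n\<close> have "e a m = e b m"
    proof (induction rule: inc_induct)
      case base
      then show ?case
        using ginj[OF ab] .
    next
      \<comment> \<open>Going down one level, \<open>f k\<close> carries equal coordinates at
        \<open>Suc k\<close> to equal ones at \<open>k\<close>.\<close>
      case (step k)
      then show ?case
        using thread[OF ab(1), of k] thread[OF ab(2), of k] by metis
    qed
    then show "g m (e a m) = g m (e b m)"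
      by simp
  next
    fix a b
    assume ab: "a \<in> topspace Y" "b \<in> topspace Y" "\<forall>n. g n (e a n) = g n (e b n)"
    then have "e a = e b"
      using ginj[OF ab(1,2)] by blast
    then show "a = b"
      using homeomorphic_imp_injective_map[OF e] ab(1,2) by (meson inj_onD)
  qed
qed

text \<open>Otherwise the points of \<open>R\<close> with the same \<open>n\<close>-th image as
  \<open>a\<close> form a decreasing sequence of nonempty closed sets. By compactness they have a
  common point, which agrees with \<open>a\<close> under every projection and so equals
  \<open>a\<close>.\<close>

lemma closedin_separated_by_projection:
  fixes \<pi> :: "nat \<Rightarrow> 'a \<Rightarrow> 'b"
  assumes "compact_space Y" "t1_space X" and \<pi>: "\<forall>n. continuous_map Y X (\<pi> n)"
    and nest: "\<forall>m n. m \<le> n \<longrightarrow> (\<forall>a\<in>topspace Y. \<forall>b\<in>topspace Y. \<pi> n a = \<pi> n b \<longrightarrow> \<pi> m a = \<pi> m b)"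
    and inj: "\<forall>a\<in>topspace Y. \<forall>b\<in>topspace Y. (\<forall>n. \<pi> n a = \<pi> n b) \<longrightarrow> a = b"
    and "closedin Y R" "a \<in> topspace Y" "a \<notin> R"
  obtains n where "\<pi> n a \<notin> \<pi> n ` R"
proof (rule ccontr)
  assume "\<not> thesis"
  then have all: "\<pi> n a \<in> \<pi> n ` R" for n
    using that by blast
  have R: "R \<subseteq> topspace Y"
    using closedin_subset assms(6) by blast
  define F where "F n = R \<inter> {b \<in> topspace Y. \<pi> n b \<in> {\<pi> n a}}" for n
  have "closedin Y (F n)" for n
  proof -
    have "\<pi> n a \<in> topspace X"
      using \<pi> assms(7) by (simp add: continuous_map_def Pi_iff)
    then have "closedin X {\<pi> n a}"
      using assms(2) closedin_t1_singleton by metis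
    then show ?thesis
      unfolding F_def using closedin_continuous_map_preimage[OF \<pi>[rule_format]] assms(6) by blast
  qed
  moreover have "F n \<noteq> {}" for n
    using all[of n] R unfolding F_def by force
  moreover have "decseq F"
    unfolding decseq_def F_def using nest assms(7) by blast
  ultimately have "(\<Inter>n. F n) \<noteq> {}"
    using compact_space_imp_nest[OF assms(1), of F] by blast
  then obtain b where b: "\<And>n. b \<in> F n"
    by blast
  then have "b \<in> R" "\<And>n. \<pi> n b = \<pi> n a"
    unfolding F_def by auto
  then show False
    using inj R assms(7,8) by blast
qed

text \<open>A failure would already be visible at one level: a single projection keeps each witness
  \<open>a i\<close> off the image of \<open>R i\<close>, and the images of \<open>H\<close> and the
  \<open>M i\<close> would violate the bound for \<open>G 0\<close>.\<close>

lemma graph_inverse_limit_bound: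
  fixes Y :: "'a topology" and G :: "nat \<Rightarrow> 'b topology"
  assumes Y: "continuum Y" and G: "\<And>n. topological_graph (G n)" "\<And>m n. G m homeomorphic_space G n"
    and lim: "Y homeomorphic_space inverse_limit G f"
  shows "\<exists>N. \<forall>(I::'i set) H M. N < card I \<longrightarrow> subcontinuum Y H \<longrightarrow>
      (\<forall>i\<in>I. subcontinuum Y (M i) \<and> M i \<inter> H \<noteq> {}) \<longrightarrow> (\<exists>i\<in>I. M i \<subseteq> H \<union> \<Union>(M ` (I - {i})))"
proof -
  have Haus: "Hausdorff_space (G n)" for n
    using G(1) by (rule topological_graph_Hausdorff)
  obtain \<pi> :: "nat \<Rightarrow> 'a \<Rightarrow> 'b" where \<pi>: "\<forall>n. continuous_map Y (G 0) (\<pi> n)"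
    "\<forall>m n. m \<le> n \<longrightarrow> (\<forall>a\<in>topspace Y. \<forall>b\<in>topspace Y. \<pi> n a = \<pi> n b \<longrightarrow> \<pi> m a = \<pi> m b)"
    "\<forall>a\<in>topspace Y. \<forall>b\<in>topspace Y. (\<forall>n. \<pi> n a = \<pi> n b) \<longrightarrow> a = b"
    using inverse_limit_projections[OF Haus G(2) lim] .
  obtain N where N: "\<forall>(I::'i set) A B. N < card I \<longrightarrow> connectedin (G 0) A \<longrightarrow>
      (\<forall>i\<in>I. connectedin (G 0) (B i) \<and> B i \<inter> A \<noteq> {}) \<longrightarrow> (\<exists>i\<in>I. B i \<subseteq> A \<union> \<Union>(B ` (I - {i})))"
    using topological_graph_bound[OF G(1)[of 0]] by (rule exE)
  show ?thesis
  proof (intro exI[of _ N] allI impI)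
    fix I :: "'i set" and H and M :: "'i \<Rightarrow> 'a set"
    assume card: "N < card I" and H: "subcontinuum Y H"
      and "\<forall>i\<in>I. subcontinuum Y (M i) \<and> M i \<inter> H \<noteq> {}"
    then have M: "subcontinuum Y (M i) \<and> M i \<inter> H \<noteq> {}" if "i \<in> I" for i
      using that by blast
    have I: "finite I"
      using card card.infinite by force
    define R where "R i = H \<union> \<Union>(M ` (I - {i}))" for i
    have Rcl: "closedin Y (R i)" for i
      unfolding R_def using H M I subcontinuum_iff_closedin[OF Y]
      by (intro closedin_Un closedin_Union) auto
    show "\<exists>i\<in>I. M i \<subseteq> H \<union> \<Union>(M ` (I - {i}))"
    proof (rule ccontr)
      assume "\<not> ?thesis"
      then have "\<forall>i\<in>I. \<exists>a. a \<in> M i \<and> a \<notin> R i"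
        unfolding R_def by blast
      then obtain a where a: "\<And>i. i \<in> I \<Longrightarrow> a i \<in> M i" "\<And>i. i \<in> I \<Longrightarrow> a i \<notin> R i"
        by metis
      have aY: "a i \<in> topspace Y" if "i \<in> I" for i
        using a(1)[OF that] M[OF that] connectedin_subset_topspace unfolding subcontinuum_def by blast
      have "\<exists>n. \<pi> n (a i) \<notin> \<pi> n ` R i" if "i \<in> I" for i
        using closedin_separated_by_projection[OF _ Hausdorff_imp_t1_space[OF Haus] \<pi>
            Rcl aY[OF that] a(2)[OF that]] Y unfolding continuum_def by blast
      then obtain n where n: "\<And>i. i \<in> I \<Longrightarrow> \<pi> (n i) (a i) \<notin> \<pi> (n i) ` R i"
        by metis
      \<comment> \<open>Each index has its own level; by nesting, the largest of these finitely many
        levels works for all.\<close>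
      define m where "m = Max (n ` I)"
      have m: "\<pi> m (a i) \<notin> \<pi> m ` R i" if "i \<in> I" for i
      proof
        assume "\<pi> m (a i) \<in> \<pi> m ` R i"
        then obtain b where b: "b \<in> R i" "\<pi> m (a i) = \<pi> m b"
          by blast
        have "n i \<le> m"
          unfolding m_def using I that by simp
        moreover have "b \<in> topspace Y"
          using b(1) Rcl closedin_subset by blast
        ultimately have "\<pi> (n i) (a i) = \<pi> (n i) b"
          using \<pi>(2) aY[OF that] b(2) by blast
        then show False
          using n[OF that] b(1) by blast
      qed
      have "\<exists>i\<in>I. \<pi> m ` M i \<subseteq> \<pi> m ` H \<union> \<Union>((\<lambda>i. \<pi> m ` M i) ` (I - {i}))"
      proof (rule N[rule_format, OF card])
        show "connectedin (G 0) (\<pi> m ` H)"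
          using H \<pi>(1) connectedin_continuous_map_image unfolding subcontinuum_def by blast
        show "connectedin (G 0) (\<pi> m ` M i) \<and> \<pi> m ` M i \<inter> \<pi> m ` H \<noteq> {}" if "i \<in> I" for i
          using M[OF that] \<pi>(1) connectedin_continuous_map_image unfolding subcontinuum_def by blast
      qed
      then obtain i where i: "i \<in> I" "\<pi> m ` M i \<subseteq> \<pi> m ` R i"
        unfolding R_def by (auto simp: image_Un image_Union image_image)
      then show False
        using m a(1) by blast
    qed
  qed
qed

section \<open>Singular dense meager composants\<close>

text \<open>If two proper closed connected pieces covered \<open>X\<close>, their closures would
  cover \<open>Y\<close>, so one closure would contain \<open>y\<close>. Singularity would make that
  piece dense in \<open>X\<close>, although it is closed in \<open>X\<close> and proper.\<close>

lemma singular_dense_closed_connected: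
  assumes X: "singular_wrt Y X y" "Y closure_of X = topspace Y"
    and C: "closedin (subtopology Y X) C" "connectedin Y C" "C \<noteq> X"
  shows "(subtopology Y X) interior_of C = {}"
proof (rule ccontr)
  let ?Z = "subtopology Y X"
  have con: "connectedin Y X" and y: "y \<in> topspace Y"
    and sing: "\<And>C. C \<subseteq> X \<Longrightarrow> connectedin Y C \<Longrightarrow> y \<in> Y closure_of C \<Longrightarrow> ?Z closure_of C = X"
    using X(1) unfolding singular_wrt_def by auto
  have top: "topspace ?Z = X"
    using connectedin_subset_topspace[OF con] by auto
  assume "?Z interior_of C \<noteq> {}"
  moreover have "connectedin ?Z C"
    using C closedin_subset top by (force simp: connectedin_subtopology)
  moreover have "connected_space ?Z"
    using con connected_space_subtopology by blast
  ultimately obtain P Q where PQ: "closedin ?Z P" "connectedin ?Z P" "P \<noteq> X"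
    "closedin ?Z Q" "connectedin ?Z Q" "Q \<noteq> X" "P \<union> Q = X"
    using closed_connected_cover_if_interior[of ?Z C] C top by metis
  have "y \<in> Y closure_of P \<union> Y closure_of Q"
    using X(2) y PQ(7) by (metis closure_of_Un)
  moreover have False if "y \<in> Y closure_of P" "closedin ?Z P" "connectedin ?Z P" "P \<noteq> X" for P
    using sing[of P] that closure_of_closedin[OF that(2)] by (auto simp: connectedin_subtopology)
  ultimately show False
    using PQ by blast
qed

lemma interior_of_finite_Union_empty:
  assumes "finite \<F>" "\<And>C. C \<in> \<F> \<Longrightarrow> closedin Z C \<and> Z interior_of C = {}"
  shows "Z interior_of \<Union>\<F> = {}"
  using assms
proof (induction rule: finite_induct)
  case (insert C \<F>)
  then show ?case
    using interior_of_closedin_union_empty_interior_of[of Z C "\<Union>\<F>"] by simp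
qed simp

text \<open>\<open>M\<close> is a subcontinuum of \<open>X\<close> through one point \<open>p\<close> of each of finitely many components of \<open>X \<inter> K\<close>.
  By boundary bumping inside \<open>M\<close>, the components \<open>P p\<close> of \<open>M \<inter> K\<close> reach \<open>H\<close>; they are pairwise disjoint.\<close>

lemma singular_dense_imp_indecomposable:
  fixes Y :: "'a topology"
  assumes Y: "continuum Y"
    and bound: "\<forall>(I::'a set) H M. N < card I \<longrightarrow> subcontinuum Y H \<longrightarrow>
      (\<forall>i\<in>I. subcontinuum Y (M i) \<and> M i \<inter> H \<noteq> {}) \<longrightarrow> (\<exists>i\<in>I. M i \<subseteq> H \<union> \<Union>(M ` (I - {i})))"
    and X: "singular_dense_in Y (meager_composant_of Y x)"
  shows "indecomposable Y"
  unfolding indecomposable_def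
proof
  let ?X = "meager_composant_of Y x"
  let ?Z = "subtopology Y ?X"
  obtain y where y: "singular_wrt Y ?X y" and dense: "Y closure_of ?X = topspace Y"
    using X unfolding singular_dense_in_def singular_in_def by blast
  have Xsub: "?X \<subseteq> topspace Y"
    using meager_composant_connectedin connectedin_subset_topspace by metis
  assume "decomposable Y"
  then obtain H K where HK: "subcontinuum Y H" "subcontinuum Y K" "H \<subset> topspace Y" "K \<subset> topspace Y"
    "topspace Y = H \<union> K"
    unfolding decomposable_def by blast
  have cl: "closedin Y H" "closedin Y K"
    using HK subcontinuum_iff_closedin[OF Y] by auto
  have dense_meets: "\<exists>w. w \<in> ?X \<and> w \<in> U" if "openin Y U" "U \<noteq> {}" for U
    using dense that unfolding dense_intersects_open by blast
  \<comment> \<open>\<open>z\<close> shows that no component of \<open>?X \<inter> K\<close> is all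
    of \<open>?X\<close>.\<close>
  obtain z where z: "z \<in> ?X" "z \<notin> K"
    using dense_meets[of "topspace Y - K"] cl HK by blast
  obtain w where w: "w \<in> ?X" "w \<notin> H"
    using dense_meets[of "topspace Y - H"] cl HK by blast
  define D where "D p = connected_component_of_set (subtopology Y (?X \<inter> K)) p" for p
  have Dcon: "connectedin Y (D p)" "D p \<subseteq> ?X \<inter> K" for p
    unfolding D_def using connectedin_connected_component_of[of "subtopology Y (?X \<inter> K)" p]
    by (auto simp: connectedin_subtopology)
  have Dcl: "closedin ?Z (D p)" for p
  proof -
    have "closedin ?Z (?X \<inter> K)"
      using cl(2) closedin_subtopology by blast
    moreover have "closedin (subtopology ?Z (?X \<inter> K)) (D p)"
      unfolding D_def subtopology_subtopology using closedin_connected_component_of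
      by (metis inf.left_idem)
    ultimately show ?thesis
      by (metis closedin_trans_full)
  qed
  have Dint: "?Z interior_of D p = {}" for p
    using singular_dense_closed_connected[OF y dense Dcl Dcon(1)] Dcon(2) z by blast
  have Dmem: "p \<in> D p" if "p \<in> ?X - H" for p
    using that Xsub HK(5) unfolding D_def by (auto simp: connected_component_of_refl)
  have "card (D ` F) \<le> N" if F: "finite F" "F \<subseteq> ?X - H" for F
  proof (rule ccontr)
    assume "\<not> card (D ` F) \<le> N"
    \<comment> \<open>\<open>I\<close> holds one representative for each of the components.\<close>
    moreover obtain I where I: "I \<subseteq> F" "inj_on D I" "D ` I = D ` F"
      using subset_image_inj[of "D ` F" D F] by auto
    ultimately have card: "N < card I"
      by (metis card_image not_le)
    have finI: "finite I"
      using I(1) F(1) finite_subset by blast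
    \<comment> \<open>Including \<open>z\<close> makes \<open>M \<inter> K\<close> a proper subset
      of \<open>M\<close>, as boundary bumping requires.\<close>
    have IX: "insert z I \<subseteq> ?X"
      using I(1) F(2) z by blast
    obtain M where M: "subcontinuum Y M" "insert z I \<subseteq> M" "M \<subseteq> ?X"
      using meager_composant_finite_subset[OF _ IX] finI by blast
    let ?T = "subtopology Y M"
    have Mtop: "topspace ?T = M"
      using M(3) Xsub by auto
    define P where "P p = connected_component_of_set (subtopology ?T (M \<inter> K)) p" for p
    have TK: "subtopology ?T (M \<inter> K) = subtopology Y (M \<inter> K)"
      by (simp add: subtopology_subtopology)
    have Pcon: "connectedin Y (P p)" "P p \<subseteq> M \<inter> K" for p
      unfolding P_def TK using connectedin_connected_component_of[of "subtopology Y (M \<inter> K)" p]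
      by (auto simp: connectedin_subtopology)
    have clM: "closedin Y M"
      using M(1) subcontinuum_iff_closedin[OF Y] by blast
    have Pcl: "closedin Y (P p)" for p
      unfolding P_def TK using closedin_Int[OF clM cl(2)]
      by (rule closedin_trans_full[OF closedin_connected_component_of])
    have Pmem: "p \<in> P p" if "p \<in> I" for p
    proof -
      have "p \<in> M \<inter> K" "p \<in> topspace Y"
        using that M(2) I(1) F(2) HK(5) Xsub by auto
      then show ?thesis
        unfolding P_def TK by (simp add: connected_component_of_refl)
    qed
    have PD: "P p \<subseteq> D p" if "p \<in> I" for p
      unfolding D_def
    proof (rule connected_component_of_maximal)
      show "connectedin (subtopology Y (?X \<inter> K)) (P p)"
        using Pcon[of p] M(3) by (auto simp: connectedin_subtopology)
    qed (use Pmem that in auto)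
    have Pmeet: "P p \<inter> H \<noteq> {}" if "p \<in> I" for p
    proof -
      have "P p \<inter> ?T frontier_of (M \<inter> K) \<noteq> {}"
      proof (rule boundary_bumping_theorem_closed)
        show "connected_space ?T" "compact_space ?T"
          using M(1) unfolding subcontinuum_def
          by (auto simp: connected_space_subtopology compact_space_subtopology)
        show "Hausdorff_space ?T"
          using continuum_Hausdorff[OF Y] Hausdorff_space_subtopology by blast
        show "closedin ?T (M \<inter> K)"
          using cl(2) closedin_subtopology by blast
        show "M \<inter> K \<noteq> topspace ?T"
          using Mtop z M(2) by blast
        have "p \<in> topspace (subtopology ?T (M \<inter> K))"
          using Pmem[OF that] Pcon(2)[of p] Mtop by auto
        then show "P p \<in> connected_components_of (subtopology ?T (M \<inter> K))"
          unfolding P_def by (simp add: connected_component_in_connected_components_of)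
      qed
      \<comment> \<open>As \<open>Y\<close> is \<open>H \<union> K\<close>, the set
        \<open>M - K\<close> lies in the closed set \<open>H\<close>, and so does its
        closure.\<close>
      moreover have "?T frontier_of (M \<inter> K) \<subseteq> H"
      proof -
        have "?T frontier_of (M \<inter> K) = ?T frontier_of (topspace ?T - M \<inter> K)"
          by (simp only: frontier_of_complement)
        also have "\<dots> \<subseteq> ?T closure_of (topspace ?T - M \<inter> K)"
          by (auto simp: frontier_of_def)
        also have "\<dots> \<subseteq> Y closure_of (topspace ?T - M \<inter> K)"
          by (rule closure_of_subtopology_subset)
        also have "\<dots> \<subseteq> H"
          using HK(5) cl(1) by (intro closure_of_minimal) auto
        finally show ?thesis .
      qed
      ultimately show ?thesis
        by blast
    qed
    have "\<exists>p\<in>I. P p \<subseteq> H \<union> \<Union>(P ` (I - {p}))"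
    proof (rule bound[rule_format, OF card HK(1)])
      show "subcontinuum Y (P p) \<and> P p \<inter> H \<noteq> {}" if "p \<in> I" for p
        using Pmeet[OF that] Pcl Pcon(1) subcontinuum_iff_closedin[OF Y] by blast
    qed
    then obtain p where p: "p \<in> I" "P p \<subseteq> H \<union> \<Union>(P ` (I - {p}))"
      by blast
    \<comment> \<open>\<open>p\<close> is outside \<open>H\<close>, so it lies in another
      \<open>P q\<close> and hence in \<open>D q\<close>. Components with a common point coincide,
      against the choice of \<open>I\<close>.\<close>
    then obtain q where q: "q \<in> I" "q \<noteq> p" "p \<in> P q"
      using Pmem[OF p(1)] I(1) F(2) by blast
    then have "p \<in> D q"
      using PD by blast
    moreover have "p \<in> D p"
      using Dmem p(1) I(1) F(2) by blast
    ultimately have "D p = D q"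
      unfolding D_def using connected_component_of_equiv[of _ q p] by simp
    then show False
      using inj_onD[OF I(2) _ p(1) q(1)] q(2) by simp
  qed
  note small = this
  have fin: "finite (D ` (?X - H))"
  proof (rule ccontr)
    assume "infinite (D ` (?X - H))"
    then obtain \<G> where \<G>: "\<G> \<subseteq> D ` (?X - H)" "finite \<G>" "card \<G> = Suc N"
      by (meson infinite_arbitrarily_large)
    then obtain F where "F \<subseteq> ?X - H" "finite F" "\<G> = D ` F"
      by (meson finite_subset_image)
    then show False
      using small[of F] \<G>(3) by simp
  qed
  have "?Z interior_of \<Union>(D ` (?X - H)) = {}"
    using Dcl Dint by (intro interior_of_finite_Union_empty[OF fin]) auto
  moreover have "openin ?Z (?X - H)"
  proof -
    have "?X - H = (topspace Y - H) \<inter> ?X"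
      using Xsub by blast
    then show ?thesis
      using cl(1) by (auto simp: openin_subtopology)
  qed
  moreover have "?X - H \<subseteq> \<Union>(D ` (?X - H))"
    using Dmem by blast
  ultimately have "?X - H = {}"
    by (meson interior_of_eq_empty)
  then show False
    using w by blast
qed

theorem corollary1p3:
  fixes Y :: "'a topology" and G :: "nat \<Rightarrow> 'b topology" and f :: "nat \<Rightarrow> 'b \<Rightarrow> 'b"
  assumes "continuum Y"
    and "\<And>n. topological_graph (G n)"
    and "\<And>m n. G m homeomorphic_space G n"
    and "\<And>n. continuous_map (G (Suc n)) (G n) (f n)"
    and "Y homeomorphic_space inverse_limit G f"
  shows "(indecomposable Y \<longleftrightarrow> (\<exists>X\<in>meager_composants Y. singular_dense_in Y X)) \<and>
         (indecomposable Y \<longleftrightarrow> (\<forall>X\<in>meager_composants Y. singular_dense_in Y X))"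
proof -
  obtain N where N: "\<forall>(I::'a set) H M. N < card I \<longrightarrow> subcontinuum Y H \<longrightarrow>
      (\<forall>i\<in>I. subcontinuum Y (M i) \<and> M i \<inter> H \<noteq> {}) \<longrightarrow> (\<exists>i\<in>I. M i \<subseteq> H \<union> \<Union>(M ` (I - {i})))"
    using graph_inverse_limit_bound[OF assms(1-3,5)] by (rule exE)
  have "indecomposable Y" if "X \<in> meager_composants Y" "singular_dense_in Y X" for X
    using that singular_dense_imp_indecomposable[OF assms(1) N] unfolding meager_composants_def by blast
  moreover have "singular_dense_in Y X" if "indecomposable Y" "X \<in> meager_composants Y" for X
    using that indecomposable_meager_composant_singular_dense[OF assms(1)]
    unfolding meager_composants_def by blast
  \<comment> \<open>This lets the universal statement yield the existential one.\<close>
  moreover have "meager_composants Y \<noteq> {}"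
    using assms(1) unfolding meager_composants_def continuum_def by blast
  ultimately show ?thesis
    by blast
qed

end
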